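(* Let $S = \{ \boldsymbol{x}_1,\dots,\boldsymbol{x}_k \} \subset \mathbb{R}^n$ be a collection of $k > n$ points, let $m, l \geq 1$ be integers such that $k = m+l$, let $S = I_m \sqcup J_l$ be a partition of $S$ with $|I_m| = m$ and $|J_l| = l$, and let $D \subseteq \mathcal{D}(I_m,J_l)$. Let $1 \leq \ell \leq n-1$. The following two statements are true: (1) If $S$ cannot be covered by fewer than $k-n+1$ parallel hyperplanes and for every subset $D'$ of $\ell$ vectors of $D$, $g(D') > \ell$, then $A(D)$ is a sensing matrix for $\ell$-sparse vectors. (2) If for every $m+l=k$ (with $m, l \geq 1$) and every partition $S = I_m \sqcup J_l$ with $|I_m| = m$, $|J_l| = l$, the matrix $A(\mathcal{D}(I_m,J_l))$ is a sensing matrix for $n$-sparse vectors, then $S$ cannot be covered by fewer than $k-n+1$ parallel hyperplanes.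
   Context: A hyperplane in $\mathbb{R}^n$ is an affine subspace of dimension $n-1$. "$S$ cannot be covered by fewer than $N$ parallel hyperplanes" means that no collection of fewer than $N$ pairwise parallel hyperplanes has union containing $S$. For a partition $S = I_m \sqcup J_l$ into two disjoint subsets of cardinalities $m, l \geq 1$, define the set of pairwise difference vectors $$\mathcal{D}(I_m,J_l) = \{ \boldsymbol{x}_i - \boldsymbol{x}_j : \boldsymbol{x}_i \in I_m, \boldsymbol{x}_j \in J_l \}.$$ For $D \subseteq \mathcal{D}(I_m,J_l)$, the support of $D$ is the set of all distinct vectors $\boldsymbol{x}_i$ that appear in the differences in $D$. $A(D)$ denotes the matrix whose column vectors are the elements of $D$. $\Gamma(D)$ denotes the bipartite graph whose vertices correspond to the support of $D$, two vertices $\boldsymbol{x}_i, \boldsymbol{x}_j$ being connected by an edge if and only if $\boldsymbol{x}_i - \boldsymbol{x}_j \in D$; in other words, $D$ is the set of edges of $\Gamma(D)$. $g(D)$ denotes the girth of $\Gamma(D)$, i.e. the minimal length of a cycle in $\Gamma(D)$ (infinite if there are no cycles). For $D' \subseteq D$, $g(D')$ is defined in the same way using $\Gamma(D')$. An $n \times d$ real matrix $A$ is a sensing matrix for $\ell$-sparse vectors, $1 \leq \ell \leq n$, if for every nonzero vector $\boldsymbol{x} \in \mathbb{R}^d$ with no more than $\ell$ nonzero coordinates, $A\boldsymbol{x} \neq \boldsymbol{0}$.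
   Formalization: In (1) the girth condition g(D') > ℓ is required for all subsets D' of at most ℓ vectors of D; this is equivalent to exactly ℓ when |D| ≥ ℓ, while for |D| < ℓ the literal condition is vacuous and the claim fails (e.g. D the four edges of a 4-cycle, ℓ = 5, n = 6). *)

theory Defs
  imports "HOL-Analysis.Analysis" "HOL-Library.Extended_Nat"
begin

section \<open>Covering by parallel hyperplanes\<close>

definition is_hyperplane :: "(real ^ 'n) set \<Rightarrow> bool" where
  "is_hyperplane H \<longleftrightarrow> affine H \<and> aff_dim H = int CARD('n) - 1"

definition covered_by_fewer_parallel_hyperplanes :: "(real ^ 'n) set \<Rightarrow> nat \<Rightarrow> bool" where
  "covered_by_fewer_parallel_hyperplanes S N \<longleftrightarrow>
     (\<exists>\<H>. finite \<H> \<and> card \<H> < N \<and>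
          (\<forall>H\<in>\<H>. is_hyperplane H) \<and>
          (\<forall>H\<in>\<H>. \<forall>H'\<in>\<H>. affine_parallel H H') \<and>
          S \<subseteq> \<Union>\<H>)"

section \<open>Undirected graphs and girth\<close>

text \<open>A graph is a pair of a vertex set and a set of two-element edges. A cycle is given by its
  cyclic sequence of vertices, so its length is the length of the list. The infimum of the
  empty set in \<^typ>\<open>enat\<close> is infinity, which is the girth of a forest.\<close>

type_synonym 'a graph = "'a set \<times> 'a set set"

definition is_cycle :: "'a graph \<Rightarrow> 'a list \<Rightarrow> bool" where
  "is_cycle G p \<longleftrightarrow>
     3 \<le> length p \<and> distinct p \<and> set p \<subseteq> fst G \<and>
     (\<forall>i<length p. {p ! i, p ! (Suc i mod length p)} \<in> snd G)"

definition girth :: "'a graph \<Rightarrow> enat" where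
  "girth G = (INF p\<in>{p. is_cycle G p}. enat (length p))"

section \<open>Difference vectors of a bipartition\<close>

definition bipartition :: "'a set \<Rightarrow> nat \<Rightarrow> nat \<Rightarrow> 'a set \<Rightarrow> 'a set \<Rightarrow> bool" where
  "bipartition S m l I J \<longleftrightarrow>
     1 \<le> m \<and> 1 \<le> l \<and> I \<union> J = S \<and> I \<inter> J = {} \<and> card I = m \<and> card J = l"

definition diff_vectors :: "(real ^ 'n) set \<Rightarrow> (real ^ 'n) set \<Rightarrow> (real ^ 'n) set" where
  "diff_vectors I J = {x - y | x y. x \<in> I \<and> y \<in> J}"

definition diff_support ::
    "(real ^ 'n) set \<Rightarrow> (real ^ 'n) set \<Rightarrow> (real ^ 'n) set \<Rightarrow> (real ^ 'n) set" where
  "diff_support I J D =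
     {x \<in> I. \<exists>y\<in>J. x - y \<in> D} \<union> {y \<in> J. \<exists>x\<in>I. x - y \<in> D}"

text \<open>\<open>D\<close> is a set of vectors, so if two pairs of points have the same difference and that
  difference lies in \<open>D\<close>, both pairs are edges.\<close>

definition diff_graph ::
    "(real ^ 'n) set \<Rightarrow> (real ^ 'n) set \<Rightarrow> (real ^ 'n) set \<Rightarrow> (real ^ 'n) graph" where
  "diff_graph I J D =
     (diff_support I J D, {{x, y} | x y. x \<in> I \<and> y \<in> J \<and> x - y \<in> D})"

section \<open>Sensing matrices\<close>

text \<open>The number of columns varies with the set of difference vectors, so it cannot be a type.
  A matrix is therefore given by a finite set \<open>C\<close> of column indices and entries \<open>a i c\<close> for
  \<open>i :: 'n\<close> and \<open>c \<in> C\<close>; a vector of coefficients is a function of which only the values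
  on \<open>C\<close> matter.\<close>

type_synonym ('n, 'c) col_matrix = "'c set \<times> ('n \<Rightarrow> 'c \<Rightarrow> real)"

definition col_matrix_mult :: "('n::finite, 'c) col_matrix \<Rightarrow> ('c \<Rightarrow> real) \<Rightarrow> real ^ 'n" where
  "col_matrix_mult A x = (\<chi> i. \<Sum>c\<in>fst A. snd A i c * x c)"

definition sensing_matrix :: "nat \<Rightarrow> ('n::finite, 'c) col_matrix \<Rightarrow> bool" where
  "sensing_matrix s A \<longleftrightarrow>
     (\<forall>x. (\<exists>c\<in>fst A. x c \<noteq> 0) \<and> card {c \<in> fst A. x c \<noteq> 0} \<le> s \<longrightarrow> col_matrix_mult A x \<noteq> 0)"

text \<open>The columns of the matrix of \<open>D\<close> are indexed by the elements of \<open>D\<close> themselves: column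
  \<open>v\<close> is the vector \<open>v\<close>. The sensing property does not depend on an ordering of the columns.\<close>

definition matrix_of_vectors :: "(real ^ 'n) set \<Rightarrow> ('n, real ^ 'n) col_matrix" where
  "matrix_of_vectors D = (D, \<lambda>i v. v $ i)"

section \<open>The girth condition\<close>

text \<open>The girth condition on subsets of \<open>s\<close> vectors of \<open>D\<close> is imposed on all subsets of at most \<open>s\<close>
  vectors. If \<open>D\<close> has at least \<open>s\<close> elements this is the same as the condition on subsets of
  exactly \<open>s\<close> vectors (lemma below). If \<open>D\<close> has fewer than \<open>s\<close> elements, the latter would be
  vacuous and would not exclude, say, that \<open>D\<close> consists of the four edges of a 4-cycle, whose
  difference vectors are linearly dependent.\<close>

lemma is_cycle_diff_graph_mono:
  assumes "D' \<subseteq> D''" "is_cycle (diff_graph I J D') p"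
  shows "is_cycle (diff_graph I J D'') p"
  using assms unfolding is_cycle_def diff_graph_def diff_support_def
  by (auto 0 4)

lemma girth_diff_graph_antimono:
  assumes "D' \<subseteq> D''"
  shows "girth (diff_graph I J D'') \<le> girth (diff_graph I J D')"
  unfolding girth_def using is_cycle_diff_graph_mono[OF assms]
  by (intro INF_superset_mono) auto

lemma girth_condition_iff_exact:
  assumes "finite D" "s \<le> card D"
  shows "(\<forall>D'\<subseteq>D. card D' \<le> s \<longrightarrow> girth (diff_graph I J D') > enat s) \<longleftrightarrow>
     (\<forall>D'\<subseteq>D. card D' = s \<longrightarrow> girth (diff_graph I J D') > enat s)"
proof
  assume R: "\<forall>D'\<subseteq>D. card D' = s \<longrightarrow> girth (diff_graph I J D') > enat s"
  show "\<forall>D'\<subseteq>D. card D' \<le> s \<longrightarrow> girth (diff_graph I J D') > enat s"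
  proof (intro allI impI)
    fix D' assume "D' \<subseteq> D" "card D' \<le> s"
    then obtain D'' where D'': "D' \<subseteq> D''" "D'' \<subseteq> D" "card D'' = s"
      using exists_subset_between[of D' s D] assms by auto
    have "enat s < girth (diff_graph I J D'')"
      using R D'' by blast
    also have "\<dots> \<le> girth (diff_graph I J D')"
      by (rule girth_diff_graph_antimono[OF D''(1)])
    finally show "girth (diff_graph I J D') > enat s" .
  qed
qed auto

end

theory Submission
  imports Defs
begin

text \<open>A set is covered by fewer than \<open>N\<close> parallel hyperplanes iff some nonzero linear functional
  takes fewer than \<open>N\<close> values on it.

  (1) Suppose that \<open>t \<le> s\<close> vectors of \<open>D\<close> are linearly dependent. Choosing one edge for each of
  them gives a forest with \<open>k - t\<close> components, and the edges span at most \<open>t - 1\<close> dimensions.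
  Joining \<open>n - t + 1\<close> of the components by \<open>n - t\<close> further differences, one still spans at most
  \<open>n - 1\<close> dimensions, so some nonzero functional vanishes on all these differences; it takes at
  most \<open>k - n\<close> values on \<open>S\<close>.

  (2) Suppose that a nonzero functional takes at most \<open>k - n\<close> values on \<open>S\<close>. Let \<open>J\<close> contain one
  point of each fibre. Subtracting from every other point the chosen point of its fibre gives at
  least \<open>n\<close> differences in the kernel, which are dependent if they are distinct. If
  \<open>x - c = x' - c'\<close> are two equal ones, a partition with \<open>I = {x, c'}\<close> has both \<open>x - c\<close> and
  its negative \<open>c' - x'\<close> as columns.\<close>

section \<open>Hyperplanes and sensing matrices\<close>

text \<open>Translates of a level set of \<open>(\<bullet>) a\<close> are again level sets of it, so
  a nonempty parallel family shares one normal vector. Conversely, the level sets at the values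
  attained on \<open>S\<close> cover \<open>S\<close>.\<close>

lemma covered_by_fewer_parallel_hyperplanes_iff:
  fixes S :: "(real ^ 'n) set"
  assumes "finite S"
  shows "covered_by_fewer_parallel_hyperplanes S N \<longleftrightarrow> (\<exists>a. a \<noteq> 0 \<and> card ((\<bullet>) a ` S) < N)"
proof
  assume "covered_by_fewer_parallel_hyperplanes S N"
  then obtain \<H> where H: "finite \<H>" "card \<H> < N" "\<And>H. H \<in> \<H> \<Longrightarrow> is_hyperplane H"
    "\<And>H H'. H \<in> \<H> \<Longrightarrow> H' \<in> \<H> \<Longrightarrow> affine_parallel H H'" "S \<subseteq> \<Union>\<H>"
    unfolding covered_by_fewer_parallel_hyperplanes_def by blast
  show "\<exists>a. a \<noteq> 0 \<and> card ((\<bullet>) a ` S) < N"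
  proof (cases "\<H> = {}")
    case True
    \<comment> \<open>The empty family has no member to supply a normal vector, but it covers only
      the empty set, where any nonzero \<open>a\<close> will do.\<close>
    then have "S = {}" using H by auto
    moreover have "\<exists>a::real^'n. a \<noteq> 0"
      using vector_choose_size[of 1] by (metis norm_zero zero_neq_one zero_le_one)
    ultimately show ?thesis using H(2) by auto
  next
    case False
    then obtain H0 where H0: "H0 \<in> \<H>" by blast
    obtain a b where ab: "a \<noteq> 0" "H0 = {x. a \<bullet> x = b}"
      using H(3)[OF H0] aff_dim_eq_hyperplane[of H0] hull_same[of affine H0]
      unfolding is_hyperplane_def by auto
    have "\<exists>c. \<forall>x\<in>H. a \<bullet> x = c" if "H \<in> \<H>" for H
      using H(4)[OF H0 that] unfolding affine_parallel_def ab
      by (auto simp: inner_add_right)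
    then obtain c where c: "\<And>H x. H \<in> \<H> \<Longrightarrow> x \<in> H \<Longrightarrow> a \<bullet> x = c H" by metis
    have "(\<bullet>) a ` S \<subseteq> c ` \<H>" using H(5) c by fastforce
    then have "card ((\<bullet>) a ` S) \<le> card \<H>"
      using H(1) surj_card_le by blast
    then show ?thesis using H(2) ab(1) by auto
  qed
next
  assume "\<exists>a. a \<noteq> 0 \<and> card ((\<bullet>) a ` S) < N"
  then obtain a where a: "a \<noteq> 0" "card ((\<bullet>) a ` S) < N" by blast
  define \<H> where "\<H> = (\<lambda>c. {x. a \<bullet> x = c}) ` (\<bullet>) a ` S"
  have "affine_parallel {x. a \<bullet> x = c} {x. a \<bullet> x = d}" for c d
  proof -
    \<comment> \<open>The multiple of \<open>a\<close> whose addition changes the value from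
      \<open>c\<close> to \<open>d\<close>.\<close>
    define v where "v = ((d - c) / (a \<bullet> a)) *\<^sub>R a"
    have v: "a \<bullet> v = d - c" using a(1) by (simp add: v_def)
    have "x \<in> (+) v ` {x. a \<bullet> x = c}" if "a \<bullet> x = d" for x
      using that v by (intro image_eqI[of _ _ "x - v"]) (auto simp: inner_diff_right)
    then have "{x. a \<bullet> x = d} = (+) v ` {x. a \<bullet> x = c}"
      using v by (auto simp: inner_add_right)
    then show ?thesis unfolding affine_parallel_def by blast
  qed
  moreover have "card \<H> < N"
    unfolding \<H>_def using a(2) assms by (meson card_image_le finite_imageI le_less_trans)
  moreover have "is_hyperplane {x. a \<bullet> x = c}" for c
    unfolding is_hyperplane_def using a(1) by (simp add: affine_hyperplane)
  moreover have "finite \<H>" "S \<subseteq> \<Union>\<H>" unfolding \<H>_def using assms by auto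
  ultimately show "covered_by_fewer_parallel_hyperplanes S N"
    unfolding covered_by_fewer_parallel_hyperplanes_def
    by (intro exI[of _ \<H>]) (auto simp: \<H>_def)
qed

lemma col_matrix_mult_matrix_of_vectors:
  "col_matrix_mult (matrix_of_vectors D) x = (\<Sum>v\<in>D. x v *\<^sub>R v)"
  by (simp add: col_matrix_mult_def matrix_of_vectors_def vec_eq_iff mult.commute)

text \<open>A dependence on \<open>B\<close>, extended by zero to \<open>D\<close>, is a sparse
  kernel vector; conversely, the support of a nonzero kernel vector is a dependent set.\<close>

lemma sensing_matrix_of_vectors_iff:
  fixes D :: "(real ^ 'n) set"
  assumes "finite D"
  shows "sensing_matrix s (matrix_of_vectors D) \<longleftrightarrow> (\<forall>B\<subseteq>D. card B \<le> s \<longrightarrow> independent B)"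
proof (intro iffI allI impI)
  fix B assume sens: "sensing_matrix s (matrix_of_vectors D)" and B: "B \<subseteq> D" "card B \<le> s"
  show "independent B"
  proof
    assume "dependent B"
    then obtain u where u: "\<exists>v\<in>B. u v \<noteq> 0" "(\<Sum>v\<in>B. u v *\<^sub>R v) = 0"
      using dependent_finite[of B] B assms finite_subset by blast
    define w where "w v = (if v \<in> B then u v else 0)" for v
    have "(\<Sum>v\<in>D. w v *\<^sub>R v) = (\<Sum>v\<in>B. u v *\<^sub>R v)"
      using B(1) assms by (intro sum.mono_neutral_cong_right) (auto simp: w_def)
    moreover have "card {v \<in> D. w v \<noteq> 0} \<le> card B"
      using B(1) assms by (intro card_mono) (auto simp: w_def finite_subset split: if_splits)
    moreover have "\<exists>v\<in>D. w v \<noteq> 0" using u(1) B(1) by (auto simp: w_def)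
    ultimately show False
      using sens u(2) B(2) unfolding sensing_matrix_def col_matrix_mult_matrix_of_vectors
      by (auto simp: matrix_of_vectors_def)
  qed
next
  assume ind: "\<forall>B\<subseteq>D. card B \<le> s \<longrightarrow> independent B"
  show "sensing_matrix s (matrix_of_vectors D)"
    unfolding sensing_matrix_def col_matrix_mult_matrix_of_vectors
  proof (intro allI impI notI, elim conjE)
    fix u assume u: "\<exists>v\<in>fst (matrix_of_vectors D). u v \<noteq> 0"
      "card {v \<in> fst (matrix_of_vectors D). u v \<noteq> 0} \<le> s" "(\<Sum>v\<in>D. u v *\<^sub>R v) = 0"
    define B where "B = {v \<in> D. u v \<noteq> 0}"
    have "(\<Sum>v\<in>B. u v *\<^sub>R v) = 0"
      using u(3) assms by (subst sum.mono_neutral_left[of D]) (auto simp: B_def)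
    moreover have "\<exists>v\<in>B. u v \<noteq> 0" "card B \<le> s" "finite B"
      using u assms by (auto simp: B_def matrix_of_vectors_def)
    ultimately have "dependent B" by (auto simp: dependent_finite)
    then show False using ind \<open>card B \<le> s\<close> by (auto simp: B_def)
  qed
qed

section \<open>Forests\<close>

text \<open>The first vertex of a longest path is a leaf: a further neighbour would either prolong
  the path or, lying on it, close a cycle.\<close>

lemma acyclic_graph_has_leaf:
  assumes fin: "finite E" and ne: "E \<noteq> {}"
    and edge: "\<And>e. e \<in> E \<Longrightarrow> \<exists>x y. x \<noteq> y \<and> e = {x, y}"
    and acyc: "\<And>p. \<not> is_cycle (\<Union>E, E) p"
  obtains x y where "x \<noteq> y" "{x, y} \<in> E" "\<And>e. e \<in> E \<Longrightarrow> x \<in> e \<Longrightarrow> e = {x, y}"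
proof -
  define path where "path p \<longleftrightarrow> distinct p \<and> 2 \<le> length p \<and> set p \<subseteq> \<Union>E \<and>
    (\<forall>i. Suc i < length p \<longrightarrow> {p ! i, p ! Suc i} \<in> E)" for p
  have "finite (\<Union>E)" using fin edge by fastforce
  then have bound: "length p \<le> card (\<Union>E)" if "path p" for p
    using that by (metis path_def distinct_card card_mono)
  obtain x0 y0 where "x0 \<noteq> y0" "{x0, y0} \<in> E" using ne edge by (metis ex_in_conv)
  then have "path [x0, y0]" by (auto simp: path_def)
  then obtain p where p: "path p" and longest: "\<And>q. path q \<Longrightarrow> length q \<le> length p"
    using Lattices_Big.ex_has_greatest_nat[of path _ length "Suc (card (\<Union>E))"] bound
    by (metis less_Suc_eq_le)
  show thesis
  proof
    have "distinct p" "0 < length p" "1 < length p" using p by (auto simp: path_def)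
    then show "p ! 0 \<noteq> p ! 1" using nth_eq_iff_index_eq[of p 0 1] by simp
    show "{p ! 0, p ! 1} \<in> E" using p by (auto simp: path_def)
    fix e assume e: "e \<in> E" "p ! 0 \<in> e"
    show "e = {p ! 0, p ! 1}"
    proof (rule ccontr)
      assume neq: "e \<noteq> {p ! 0, p ! 1}"
      obtain z where z: "e = {p ! 0, z}" "z \<noteq> p ! 0" using edge[OF e(1)] e(2) by auto
      have "z \<in> set p"
      proof (rule ccontr)
        assume "z \<notin> set p"
        then have "path (z # p)"
          using p e(1) z
          by (auto simp: path_def nth_Cons insert_commute split: nat.splits)
        then show False using longest by fastforce
      qed
      then obtain j where j: "j < length p" "p ! j = z" by (auto simp: in_set_conv_nth)
      \<comment> \<open>So the initial segment of the path up to \<open>z\<close> has at least three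
        vertices, and \<open>e\<close> closes it to a cycle.\<close>
      have "j \<noteq> 0" "j \<noteq> 1" using j z neq by (metis, metis)
      then have j2: "2 \<le> j" by simp
      have len: "length (take (Suc j) p) = Suc j" using j by simp
      have "{take (Suc j) p ! i, take (Suc j) p ! (Suc i mod Suc j)} \<in> E" if "i < Suc j" for i
      proof (cases "i = j")
        case True
        then show ?thesis using e(1) z(1) j by (simp add: insert_commute)
      next
        case False
        then show ?thesis using that p j by (auto simp: path_def)
      qed
      then have "is_cycle (\<Union>E, E) (take (Suc j) p)"
        using p j2 set_take_subset[of "Suc j" p] unfolding is_cycle_def len
        by (auto simp: path_def)
      then show False using acyc by blast
    qed
  qed
qed

lemma is_cycle_mono:
  assumes "is_cycle (V, E) p" "V \<subseteq> V'" "E \<subseteq> E'"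
  shows "is_cycle (V', E') p"
  using assms unfolding is_cycle_def by auto

text \<open>Removing a leaf deletes one vertex and one edge, which keeps the count and lets
  \<open>T\<close> stay the same; the leaf reaches \<open>T\<close> through its neighbour. Without
  edges, \<open>T\<close> is all of \<open>S\<close>.\<close>

lemma forest_component_representatives:
  assumes "finite S" "finite E"
    and "\<And>e. e \<in> E \<Longrightarrow> \<exists>x y. x \<noteq> y \<and> e = {x, y}" and "\<Union>E \<subseteq> S"
    and "\<And>p. \<not> is_cycle (S, E) p"
  shows "\<exists>T\<subseteq>S. card T + card E = card S \<and> (\<forall>x\<in>S. \<exists>r\<in>T. (x, r) \<in> {(x, y). {x, y} \<in> E}\<^sup>*)"
  using assms
proof (induction "card E" arbitrary: S E)
  case 0
  then show ?case by (intro exI[of _ S]) auto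
next
  case (Suc d)
  have acyc: "\<not> is_cycle (\<Union>E, E) p" for p
    using Suc.prems(4) Suc.prems(5)[of p] is_cycle_mono[of "\<Union>E" E p S E] by auto
  have ne: "E \<noteq> {}" using Suc.hyps(2) by auto
  obtain x y where xy: "x \<noteq> y" "{x, y} \<in> E"
    and leaf: "\<And>e. e \<in> E \<Longrightarrow> x \<in> e \<Longrightarrow> e = {x, y}"
    using acyclic_graph_has_leaf[OF Suc.prems(2) ne Suc.prems(3) acyc] by blast
  have "x \<in> S" "y \<in> S" using xy Suc.prems(4) by auto
  let ?S = "S - {x}" and ?E = "E - {{x, y}}"
  have cE: "Suc (card ?E) = card E" and cS: "Suc (card ?S) = card S"
    using card_Suc_Diff1[OF Suc.prems(2) xy(2)] card_Suc_Diff1[OF Suc.prems(1) \<open>x \<in> S\<close>] by auto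
  have "\<exists>T\<subseteq>?S. card T + card ?E = card ?S \<and> (\<forall>z\<in>?S. \<exists>r\<in>T. (z, r) \<in> {(x, y). {x, y} \<in> ?E}\<^sup>*)"
  proof (rule Suc.hyps(1))
    show "d = card ?E" using Suc.hyps(2) cE by simp
    show "finite ?S" "finite ?E" using Suc.prems(1,2) by auto
    show "\<exists>x y. x \<noteq> y \<and> e = {x, y}" if "e \<in> ?E" for e
      by (rule Suc.prems(3)) (use that in simp)
    show "\<Union>?E \<subseteq> ?S" using leaf Suc.prems(4) by blast
    show "\<not> is_cycle (?S, ?E) p" for p
      using Suc.prems(5)[of p] is_cycle_mono[of ?S ?E p S E] by auto
  qed
  then obtain T where T: "T \<subseteq> ?S" "card T + card ?E = card ?S"
    "\<And>z. z \<in> ?S \<Longrightarrow> \<exists>r\<in>T. (z, r) \<in> {(x, y). {x, y} \<in> ?E}\<^sup>*" by blast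
  have mono: "{(x, y). {x, y} \<in> ?E}\<^sup>* \<subseteq> {(x, y). {x, y} \<in> E}\<^sup>*"
    by (intro rtrancl_mono) auto
  have "\<exists>r\<in>T. (z, r) \<in> {(x, y). {x, y} \<in> E}\<^sup>*" if "z \<in> S" for z
  proof (cases "z = x")
    case True
    obtain r where "r \<in> T" "(y, r) \<in> {(x, y). {x, y} \<in> E}\<^sup>*"
      using T(3)[of y] \<open>y \<in> S\<close> xy(1) mono by blast
    then show ?thesis
      using True xy(2) by (auto intro: converse_rtrancl_into_rtrancl)
  next
    case False
    then show ?thesis using T(3)[of z] that mono by blast
  qed
  then show ?case using T(1,2) cE cS by (intro exI[of _ T]) auto
qed

text \<open>The edges at different positions of a cycle are distinct. This turns a girth larger than
  the number of edges into acyclicity.\<close>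

lemma cycle_length_le_card_edges:
  assumes "is_cycle (V, E) p" "finite E"
  shows "length p \<le> card E"
proof -
  define L where "L = length p"
  have L: "3 \<le> L" and dist: "distinct p"
    and edges: "\<And>i. i < L \<Longrightarrow> {p ! i, p ! (Suc i mod L)} \<in> E"
    using assms(1) unfolding is_cycle_def L_def by auto
  have "inj_on (\<lambda>i. {p ! i, p ! (Suc i mod L)}) {..<L}"
  proof (rule inj_onI, rule ccontr)
    fix i j assume ij: "i \<in> {..<L}" "j \<in> {..<L}" "i \<noteq> j"
      "{p ! i, p ! (Suc i mod L)} = {p ! j, p ! (Suc j mod L)}"
    have "0 < L" using L by simp
    have "p ! a = p ! b \<longleftrightarrow> a = b" if "a < L" "b < L" for a b
      using dist that by (simp add: nth_eq_iff_index_eq L_def)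
    moreover have "Suc i mod L < L" "Suc j mod L < L" using \<open>0 < L\<close> by auto
    \<comment> \<open>Equal edges at distinct positions are traversed in opposite directions, so
      each index is the cyclic successor of the other, impossible when \<open>L\<close> is at least
      3.\<close>
    ultimately have "i = Suc j mod L" "j = Suc i mod L"
      using ij by (auto simp: doubleton_eq_iff)
    moreover have "Suc a mod L = (if Suc a = L then 0 else Suc a)" if "a < L" for a
      using that by auto
    ultimately show False using ij(1-3) L by (auto split: if_splits)
  qed
  then have "card {..<L} \<le> card E"
    using edges assms(2) by (intro card_inj_on_le) auto
  then show ?thesis by (simp add: L_def)
qed

section \<open>The two implications\<close>

lemma independent_if_girth_and_uncovered:
  fixes S I J B :: "(real ^ 'n) set"
  assumes fin: "finite S" and k: "CARD('n) < card S" and SIJ: "S = I \<union> J" "I \<inter> J = {}"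
    and B: "B \<subseteq> diff_vectors I J" "finite B" "card B < CARD('n)"
    and girth: "enat (card B) < girth (diff_graph I J B)"
    and uncov: "\<not> covered_by_fewer_parallel_hyperplanes S (card S - CARD('n) + 1)"
  shows "independent B"
proof
  assume dep: "dependent B"
  \<comment> \<open>A vector may be the difference of several pairs. Fixing one pair for each gives
    exactly \<open>card B\<close> edges, possibly fewer than \<open>diff_graph I J B\<close>
    has.\<close>
  have "\<exists>q. fst q \<in> I \<and> snd q \<in> J \<and> v = fst q - snd q" if "v \<in> B" for v
    using B(1) that unfolding diff_vectors_def by fastforce
  then obtain q where q: "\<And>v. v \<in> B \<Longrightarrow> fst (q v) \<in> I \<and> snd (q v) \<in> J \<and> v = fst (q v) - snd (q v)"
    by metis
  define edge where "edge v = {fst (q v), snd (q v)}" for v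
  define E where "E = edge ` B"
  have "inj_on edge B"
  proof (rule inj_onI)
    fix v w assume vw: "v \<in> B" "w \<in> B" "edge v = edge w"
    \<comment> \<open>Disjointness of \<open>I\<close> and \<open>J\<close> lets an unordered edge
      determine its orientation, hence its difference.\<close>
    then have "fst (q v) = fst (q w) \<and> snd (q v) = snd (q w)"
      using q[of v] q[of w] SIJ(2) by (auto simp: edge_def doubleton_eq_iff)
    then show "v = w" using q vw by metis
  qed
  then have cE: "card E = card B" unfolding E_def by (rule card_image)
  have "finite E" using B(2) by (simp add: E_def)
  have edgeD: "\<exists>x\<in>I. \<exists>y\<in>J. x - y \<in> B \<and> e = {x, y}" if "e \<in> E" for e
    using that q unfolding E_def edge_def by (metis (no_types, lifting) imageE)
  have acyc: "\<not> is_cycle (S, E) p" for p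
  proof
    assume cyc: "is_cycle (S, E) p"
    have E_sub: "E \<subseteq> snd (diff_graph I J B)"
    proof
      fix e assume "e \<in> E"
      from edgeD[OF this] show "e \<in> snd (diff_graph I J B)" by (auto simp: diff_graph_def)
    qed
    have E_supp: "\<Union>E \<subseteq> diff_support I J B"
    proof (rule Union_least)
      fix e assume "e \<in> E"
      from edgeD[OF this] show "e \<subseteq> diff_support I J B" by (auto simp: diff_support_def)
    qed
    have "set p \<subseteq> \<Union>E"
    proof
      fix z assume "z \<in> set p"
      then obtain i where "i < length p" "z = p ! i" by (auto simp: in_set_conv_nth)
      then show "z \<in> \<Union>E" using cyc unfolding is_cycle_def by auto
    qed
    then have "is_cycle (diff_graph I J B) p"
      using cyc E_sub E_supp unfolding is_cycle_def by (auto simp: diff_graph_def)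
    then have "girth (diff_graph I J B) \<le> enat (length p)"
      unfolding girth_def by (intro INF_lower) auto
    also have "\<dots> \<le> enat (card B)"
      using cycle_length_le_card_edges[OF cyc \<open>finite E\<close>] cE by simp
    finally show False using girth by (simp add: not_less[symmetric])
  qed
  have doubleton: "\<exists>x y. x \<noteq> y \<and> e = {x, y}" if "e \<in> E" for e
  proof -
    obtain x y where xy: "x \<in> I" "y \<in> J" "e = {x, y}"
      using edgeD[OF \<open>e \<in> E\<close>] by auto
    then have "x \<noteq> y" using SIJ(2) by auto
    then show ?thesis using xy(3) by (intro exI[of _ x] exI[of _ y] conjI)
  qed
  have "e \<subseteq> S" if "e \<in> E" for e
    using edgeD[OF that] SIJ(1) by auto
  then have "\<Union>E \<subseteq> S" by (rule Union_least)
  then have "\<exists>T\<subseteq>S. card T + card E = card S \<and>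
    (\<forall>x\<in>S. \<exists>r\<in>T. (x, r) \<in> {(x, y). {x, y} \<in> E}\<^sup>*)"
    by (intro forest_component_representatives fin \<open>finite E\<close> doubleton acyc)
  then obtain T where T: "T \<subseteq> S" "card T + card B = card S"
    "\<forall>x\<in>S. \<exists>r\<in>T. (x, r) \<in> {(x, y). {x, y} \<in> E}\<^sup>*"
    unfolding cE by (elim exE conjE) (rule that)
  have "finite T" using T(1) fin finite_subset by blast
  have "CARD('n) - card B + 1 \<le> card T" using T(2) k B(3) by linarith
  \<comment> \<open>Representatives of the components to be joined; their differences to one
    \<open>r0\<close> number \<open>CARD('n) - card B\<close>.\<close>
  then obtain R where R: "R \<subseteq> T" "card R = CARD('n) - card B + 1"
    by (metis obtain_subset_with_card_n)
  have "finite R" using R(1) \<open>finite T\<close> finite_subset by blast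
  obtain r0 where r0: "r0 \<in> R" using R(2) by fastforce
  obtain b where b: "b \<in> B" "b \<in> span (B - {b})" using dep unfolding dependent_def by blast
  \<comment> \<open>Dropping the redundant \<open>b\<close> leaves \<open>card B - 1\<close>
    vectors, so \<open>W\<close> has at most \<open>CARD('n) - 1\<close> elements and lies in a
    hyperplane through the origin.\<close>
  define W where "W = (B - {b}) \<union> (\<lambda>r. r - r0) ` (R - {r0})"
  have "card B > 0" using b(1) B(2) card_gt_0_iff by blast
  have "finite W" using B(2) \<open>finite R\<close> by (simp add: W_def)
  have "card W \<le> card (B - {b}) + card ((\<lambda>r. r - r0) ` (R - {r0}))"
    unfolding W_def by (rule card_Un_le)
  also have "\<dots> \<le> (card B - 1) + (CARD('n) - card B)"
    using b(1) R(2) r0 \<open>finite R\<close> B(2) card_image_le[of "R - {r0}" "\<lambda>r. r - r0"]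
    by (intro add_mono) auto
  also have "\<dots> < CARD('n)" using B(3) \<open>card B > 0\<close> by simp
  finally have "dim W < DIM(real ^ 'n)"
    using dim_le_card'[OF \<open>finite W\<close>] by simp
  then obtain a where a: "a \<noteq> 0" "span W \<subseteq> {x. a \<bullet> x = 0}"
    using lowdim_subset_hyperplane by blast
  have "B \<subseteq> span W"
  proof
    fix v assume "v \<in> B"
    then show "v \<in> span W"
      using b(2) span_mono[of "B - {b}" W] by (cases "v = b") (auto simp: W_def intro: span_base)
  qed
  then have aB: "a \<bullet> v = 0" if "v \<in> B" for v using a(2) that by auto
  have aR: "a \<bullet> r = a \<bullet> r0" if "r \<in> R" for r
  proof (cases "r = r0")
    case False
    then have "r - r0 \<in> span W" using that by (auto simp: W_def intro: span_base)
    then show ?thesis using a(2) by (auto simp: inner_diff_right)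
  qed simp
  have aE: "a \<bullet> x = a \<bullet> y" if "{x, y} \<in> E" for x y
  proof -
    obtain u w where uw: "u - w \<in> B" "{x, y} = {u, w}"
      using edgeD[OF \<open>{x, y} \<in> E\<close>] by metis
    have "a \<bullet> u = a \<bullet> w" using aB[OF uw(1)] by (simp add: inner_diff_right)
    then show ?thesis using uw(2) by (auto simp: doubleton_eq_iff)
  qed
  have aT: "a \<bullet> x = a \<bullet> y" if "(x, y) \<in> {(x, y). {x, y} \<in> E}\<^sup>*" for x y
    using that by (induction rule: rtrancl_induct) (auto dest: aE)
  \<comment> \<open>The functional is constant on components, so \<open>T\<close> attains all its
    values on \<open>S\<close>; among these \<open>r0\<close> accounts for all of
    \<open>R\<close>.\<close>
  have "(\<bullet>) a ` S \<subseteq> (\<bullet>) a ` (T - (R - {r0}))"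
  proof
    fix c assume "c \<in> (\<bullet>) a ` S"
    then obtain x where x: "x \<in> S" "c = a \<bullet> x" by blast
    then obtain r where r: "r \<in> T" "c = a \<bullet> r" using T(3) aT by metis
    show "c \<in> (\<bullet>) a ` (T - (R - {r0}))"
    proof (cases "r \<in> R")
      case True
      then have "c = a \<bullet> r0" using r(2) aR by metis
      then show ?thesis using r0 R(1) by auto
    qed (use r in auto)
  qed
  then have "card ((\<bullet>) a ` S) \<le> card (T - (R - {r0}))"
    using \<open>finite T\<close> surj_card_le[of "T - (R - {r0})"] by auto
  also have "\<dots> = card T - (card R - 1)"
    using R(1) r0 \<open>finite R\<close> by (subst card_Diff_subset) auto
  \<comment> \<open>With \<open>card T = card S - card B\<close> and
    \<open>card R - 1 = CARD('n) - card B\<close>, the left side is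
    \<open>card S - CARD('n)\<close>.\<close>
  also have "\<dots> < card S - CARD('n) + 1" using T(2) R(2) B(3) k by simp
  finally show False
    using uncov a(1) covered_by_fewer_parallel_hyperplanes_iff[OF fin] by blast
qed

lemma finite_diff_vectors:
  assumes "finite I" "finite J"
  shows "finite (diff_vectors I J)"
proof -
  have "diff_vectors I J = (\<lambda>(x, y). x - y) ` (I \<times> J)" by (auto simp: diff_vectors_def)
  then show ?thesis using assms by simp
qed

lemma uncovered_if_independent:
  fixes S :: "(real ^ 'n) set"
  assumes fin: "finite S" and n: "2 \<le> CARD('n)" "CARD('n) < card S"
    and ind: "\<And>I J B. I \<union> J = S \<Longrightarrow> I \<inter> J = {} \<Longrightarrow> I \<noteq> {} \<Longrightarrow> J \<noteq> {} \<Longrightarrow>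
      B \<subseteq> diff_vectors I J \<Longrightarrow> card B \<le> CARD('n) \<Longrightarrow> independent B"
  shows "\<not> covered_by_fewer_parallel_hyperplanes S (card S - CARD('n) + 1)"
proof
  assume "covered_by_fewer_parallel_hyperplanes S (card S - CARD('n) + 1)"
  then obtain a where a: "a \<noteq> 0" "card ((\<bullet>) a ` S) \<le> card S - CARD('n)"
    using covered_by_fewer_parallel_hyperplanes_iff[OF fin] by fastforce
  have "\<exists>z\<in>S. a \<bullet> z = d" if "d \<in> (\<bullet>) a ` S" for d using that by auto
  \<comment> \<open>\<open>c d\<close> is the chosen point of the fibre over the value
    \<open>d\<close>.\<close>
  then obtain c where c: "\<And>d. d \<in> (\<bullet>) a ` S \<Longrightarrow> c d \<in> S \<and> a \<bullet> c d = d" by metis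
  define J where "J = c ` (\<bullet>) a ` S"
  define I where "I = S - J"
  define f where "f x = x - c (a \<bullet> x)" for x
  have "J \<subseteq> S" unfolding J_def using c by blast
  have "card J \<le> card S - CARD('n)"
    using a(2) card_image_le[of "(\<bullet>) a ` S" c] fin unfolding J_def by fastforce
  then have cI: "CARD('n) \<le> card I"
    using \<open>J \<subseteq> S\<close> fin n(2) by (simp add: I_def card_Diff_subset finite_subset)
  have cJ: "c (a \<bullet> x) \<in> J" if "x \<in> S" for x using that by (simp add: J_def)
  show False
  proof (cases "inj_on f I")
    case True
    then obtain B where B: "B \<subseteq> f ` I" "card B = CARD('n)"
      using obtain_subset_with_card_n[of "CARD('n)" "f ` I"] cI card_image by metis
    have "S \<noteq> {}" using n by auto
    then have "J \<noteq> {}" by (simp add: J_def)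
    moreover have "I \<noteq> {}" using cI n by auto
    moreover have "B \<subseteq> diff_vectors I J"
      using B(1) cJ by (fastforce simp: diff_vectors_def f_def I_def)
    ultimately have "independent B"
      using ind[of I J B] B(2) \<open>J \<subseteq> S\<close> unfolding I_def by auto
    moreover have "B \<subseteq> {x. a \<bullet> x = 0}"
      using B(1) c by (fastforce simp: f_def I_def inner_diff_right)
    \<comment> \<open>The kernel of \<open>(\<bullet>) a\<close> has dimension only
      \<open>CARD('n) - 1\<close>.\<close>
    ultimately have "card B \<le> dim {x. a \<bullet> x = 0}"
      by (metis independent_card_le_dim)
    then show False using B(2) a(1) n by (simp add: dim_hyperplane)
  next
    case False
    then obtain x x' where x: "x \<in> I" "x' \<in> I" "x \<noteq> x'" "f x = f x'"
      by (auto simp: inj_on_def)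
    define z z' where "z = c (a \<bullet> x)" and "z' = c (a \<bullet> x')"
    have eq: "x - z = x' - z'" using x(4) by (simp add: f_def z_def z'_def)
    have z: "z \<in> J" "z' \<in> J" using x cJ by (auto simp: z_def z'_def I_def)
    \<comment> \<open>If \<open>z = z'\<close>, then \<open>x = x'\<close>; the other inequalities
      hold because \<open>I\<close> and \<open>J\<close> are disjoint. They keep \<open>z\<close>
      and \<open>x'\<close> outside \<open>{x, z'}\<close>.\<close>
    then have z': "z \<noteq> z'" "x \<noteq> z" "x' \<noteq> z'" "x \<noteq> z'" "x' \<noteq> z"
      using eq x unfolding I_def by auto
    define w where "w = x - z"
    have "independent {w, -w}"
    proof (rule ind)
      show "{x, z'} \<union> (S - {x, z'}) = S" using x z \<open>J \<subseteq> S\<close> by (auto simp: I_def)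
      show "S - {x, z'} \<noteq> {}" using z z' \<open>J \<subseteq> S\<close> by blast
      have "z \<in> S - {x, z'}" "x' \<in> S - {x, z'}" using z z' x \<open>J \<subseteq> S\<close> by (auto simp: I_def)
      moreover have "- w = z' - x'" using eq by (simp add: w_def)
      ultimately show "{w, - w} \<subseteq> diff_vectors {x, z'} (S - {x, z'})"
        unfolding diff_vectors_def w_def by blast
      show "card {w, - w} \<le> CARD('n)" using n card_insert_le_m1[of 2 "{- w}" w] by auto
    qed auto
    moreover have "w \<noteq> 0" using z' by (simp add: w_def)
    \<comment> \<open>Otherwise \<open>{w, - w}\<close> would be a singleton, and independent since
      \<open>w\<close> is nonzero.\<close>
    then have "w \<noteq> - w"
      by (metis eq_neg_iff_add_eq_0 scaleR_2 scaleR_eq_0_iff zero_neq_numeral)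
    ultimately have "- w \<notin> span ({w, - w} - {- w})" "w \<noteq> - w"
      by (auto simp: dependent_def)
    then show False by (simp add: insert_Diff_if span_neg span_base)
  qed
qed

theorem theorem1p3:
  fixes S I J D :: "(real ^ 'n) set" and k m l s :: nat
  assumes "finite S" and "card S = k" and "k > CARD('n)"
    and "k = m + l" and "bipartition S m l I J"
    and "D \<subseteq> diff_vectors I J"
    and "1 \<le> s" and "s \<le> CARD('n) - 1"
  shows "(\<not> covered_by_fewer_parallel_hyperplanes S (k - CARD('n) + 1) \<and>
            (\<forall>D'\<subseteq>D. card D' \<le> s \<longrightarrow> girth (diff_graph I J D') > enat s)
          \<longrightarrow> sensing_matrix s (matrix_of_vectors D))
       \<and> ((\<forall>m' l' I' J'. m' + l' = k \<and> bipartition S m' l' I' J'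
              \<longrightarrow> sensing_matrix CARD('n) (matrix_of_vectors (diff_vectors I' J')))
          \<longrightarrow> \<not> covered_by_fewer_parallel_hyperplanes S (k - CARD('n) + 1))"
proof (intro conjI impI)
  have IJ: "S = I \<union> J" "I \<inter> J = {}" using assms(5) by (auto simp: bipartition_def)
  then have "finite D"
    using finite_subset[OF assms(6)] finite_diff_vectors[of I J] assms(1) by auto
  assume *: "\<not> covered_by_fewer_parallel_hyperplanes S (k - CARD('n) + 1) \<and>
    (\<forall>D'\<subseteq>D. card D' \<le> s \<longrightarrow> girth (diff_graph I J D') > enat s)"
  have "independent B" if B: "B \<subseteq> D" "card B \<le> s" for B
  proof (rule independent_if_girth_and_uncovered[OF assms(1) _ IJ])
    \<comment> \<open>\<open>B\<close> itself serves as \<open>D'\<close>: its girth exceeds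
      \<open>s\<close>, which is at least \<open>card B\<close>. Here subsets with fewer than
      \<open>s\<close> vectors matter.\<close>
    show "enat (card B) < girth (diff_graph I J B)"
      using * B by (meson enat_ord_simps(1) le_less_trans)
  qed (use * B assms finite_subset[OF B(1) \<open>finite D\<close>] in auto)
  then show "sensing_matrix s (matrix_of_vectors D)"
    using sensing_matrix_of_vectors_iff[OF \<open>finite D\<close>] by blast
next
  assume *: "\<forall>m' l' I' J'. m' + l' = k \<and> bipartition S m' l' I' J'
    \<longrightarrow> sensing_matrix CARD('n) (matrix_of_vectors (diff_vectors I' J'))"
  have "independent B" if IJ: "I' \<union> J' = S" "I' \<inter> J' = {}" "I' \<noteq> {}" "J' \<noteq> {}"
    and B: "B \<subseteq> diff_vectors I' J'" "card B \<le> CARD('n)" for I' J' B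
  proof -
    have fin: "finite I'" "finite J'" using IJ(1) assms(1) by auto
    have "card I' + card J' = k" using card_Un_disjoint[OF fin IJ(2)] IJ(1) assms(2) by simp
    moreover have "bipartition S (card I') (card J') I' J'"
      using IJ fin by (auto simp: bipartition_def Suc_le_eq card_gt_0_iff)
    ultimately show ?thesis
      using * B sensing_matrix_of_vectors_iff[OF finite_diff_vectors[OF fin]] by blast
  qed
  \<comment> \<open>The bounds on \<open>s\<close> force \<open>CARD('n)\<close> to be at least 2,
    which admits the two columns \<open>w\<close> and \<open>- w\<close>.\<close>
  then show "\<not> covered_by_fewer_parallel_hyperplanes S (k - CARD('n) + 1)"
    using uncovered_if_independent[OF assms(1)] assms(2,3,7,8) by auto
qed

end
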